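(* Let $G=(V,E)$ be a finite graph with $V=\{1,\ldots,n\}$, let $A$ be its adjacency matrix and $Q=\mathrm{diag}(d(i))_{i\in V}-A$ its Laplace matrix, where $d(i)$ is the degree of $i$. Let $U\subseteq V$ and let $c\ge 0$ be such that for every $W\subseteq V\setminus U$ we have $|N(W)\setminus W|\ge c|W|$, where $N(W)$ is the set of all vertices that have a neighbor in $W$. Let $x=(x_1,\ldots,x_n)\in\mathbb R^n$ satisfy $x_j=0$ for all $j\in U$. Then $$x^t Q x \ge \frac{c^2}{4+2c^2}\sum_{i\in V} x_i^2.$$ *)

theory Defs
  imports "Graph_Theory.Digraph" "Jordan_Normal_Form.Matrix"
begin

text \<open>
  A finite simple undirected graph is an instance of the locale \<^locale>\<open>graph\<close>, in which every
  edge \<open>{u, v}\<close> is represented by the two arcs \<open>(u, v)\<close> and \<open>(v, u)\<close>; hence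
  \<^const>\<open>out_degree\<close> is the degree.  Matrices and vectors are indexed from 0, so the vertex set
  of a graph on \<open>n\<close> vertices is taken to be \<open>{0..<n}\<close>.
\<close>

definition adjacency_mat :: "nat \<Rightarrow> (nat, 'b) pre_digraph \<Rightarrow> real mat" where
  "adjacency_mat n G = mat n n (\<lambda>(i, j). if i \<rightarrow>\<^bsub>G\<^esub> j then 1 else 0)"

definition laplace_mat :: "nat \<Rightarrow> (nat, 'b) pre_digraph \<Rightarrow> real mat" where
  "laplace_mat n G = mat_diag n (\<lambda>i. real (out_degree G i)) - adjacency_mat n G"

definition neighborhood :: "('a, 'b) pre_digraph \<Rightarrow> 'a set \<Rightarrow> 'a set" where
  "neighborhood G W = {v \<in> verts G. \<exists>w\<in>W. v \<rightarrow>\<^bsub>G\<^esub> w}"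

end

theory Submission
  imports Defs
begin

text \<open>
  Every \<open>S \<subseteq> V \<setminus> U\<close> satisfies \<open>|S \<union> N(S)| \<ge> (1 + c) |S|\<close>, so by a
  fractional version of Hall's theorem there is \<open>h \<ge> 0\<close>, supported on the edges and
  the diagonal, with row sums \<open>1 + c\<close> on \<open>V \<setminus> U\<close> and column sums at most \<open>1\<close>.
  Put \<open>g(i,j) = h(i,j) - h(j,i)\<close>.
  The net outflow of \<open>h\<close> is at least \<open>c\<close> at every vertex with \<open>x\<^sub>i \<noteq> 0\<close>, so
  \<open>\<Sum> g(i,j) (x\<^sub>i\<^sup>2 - x\<^sub>j\<^sup>2) \<ge> 2 c \<Sum> x\<^sub>i\<^sup>2\<close>.  On the other hand
  \<open>\<Sum>\<^sub>j g(i,j)\<^sup>2 \<le> 2 + c\<^sup>2\<close>, so factoring \<open>x\<^sub>i\<^sup>2 - x\<^sub>j\<^sup>2 = (x\<^sub>i + x\<^sub>j)(x\<^sub>i - x\<^sub>j)\<close> and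
  applying the Cauchy-Schwarz inequality bounds the Dirichlet form from below.
\<close>

section \<open>A fractional Hall theorem: feasibility of a transportation problem\<close>

text \<open>Read \<open>a\<close> as supplies, \<open>b\<close> as capacities and \<open>R\<close>
  as the admissible routes. The induction rests on two reductions: a vertex whose supply or capacity
  is zero can be deleted, and a set for which Hall's inequality is an equality splits the problem
  into two independent smaller ones. Requiring \<open>h\<close> to vanish off \<open>I\<close> and
  \<open>J\<close> lets solutions of subproblems be extended by zero and added.\<close>

lemma fractional_Hall:
  fixes a :: "'a \<Rightarrow> real" and b :: "'b \<Rightarrow> real"
  assumes "finite I" "finite J"
    and "\<And>i. i \<in> I \<Longrightarrow> a i \<ge> 0" "\<And>j. j \<in> J \<Longrightarrow> b j \<ge> 0"
    and "\<And>S. S \<subseteq> I \<Longrightarrow> sum a S \<le> sum b {j\<in>J. \<exists>i\<in>S. R i j}"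
  shows "\<exists>h. (\<forall>i j. h i j \<ge> 0) \<and> (\<forall>i j. h i j \<noteq> 0 \<longrightarrow> i \<in> I \<and> j \<in> J \<and> R i j) \<and>
           (\<forall>i\<in>I. (\<Sum>j\<in>J. h i j) = a i) \<and> (\<forall>j\<in>J. (\<Sum>i\<in>I. h i j) \<le> b j)"
  using assms
proof (induction "card I + card J" arbitrary: I J a b rule: less_induct)
  case less
  note fin = less.prems(1,2) and a0 = less.prems(3) and b0 = less.prems(4)
    and Hall = less.prems(5)
  let ?P = "\<lambda>I J a b (h :: 'a \<Rightarrow> 'b \<Rightarrow> real). (\<forall>i j. h i j \<ge> 0) \<and>
           (\<forall>i j. h i j \<noteq> 0 \<longrightarrow> i \<in> I \<and> j \<in> J \<and> R i j) \<and>
           (\<forall>i\<in>I. (\<Sum>j\<in>J. h i j) = a i) \<and> (\<forall>j\<in>J. (\<Sum>i\<in>I. h i j) \<le> b j)"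
  \<comment> \<open>General in \<open>a\<close> and \<open>b\<close> because it serves both the
    original data and the reduced data \<open>a'\<close>, \<open>b'\<close> below.\<close>
  have drop_row: "\<exists>h. ?P I J a b h"
    if "i \<in> I" "a i = 0" and a0: "\<And>i. i \<in> I \<Longrightarrow> a i \<ge> 0" and b0: "\<And>j. j \<in> J \<Longrightarrow> b j \<ge> 0"
      and Hall: "\<And>S. S \<subseteq> I \<Longrightarrow> sum a S \<le> sum b {j\<in>J. \<exists>i\<in>S. R i j}" for i a b
  proof -
    have "\<exists>h. ?P (I - {i}) J a b h"
    proof (rule less.hyps)
      show "card (I - {i}) + card J < card I + card J"
        using card_Diff1_less[OF fin(1) that(1)] by simp
      show "sum a S \<le> sum b {j\<in>J. \<exists>i\<in>S. R i j}" if "S \<subseteq> I - {i}" for S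
        using that Hall[of S] by blast
    qed (use fin a0 b0 in auto)
    then obtain h where h: "?P (I - {i}) J a b h" by blast
    have zero: "h i j = 0" for j using h by blast
    have "(\<Sum>i\<in>I. h i j) = (\<Sum>i\<in>I - {i}. h i j)" for j
      using that(1) fin zero by (simp add: sum.remove)
    moreover have "(\<Sum>j\<in>J. h k j) = a k" if "k \<in> I" for k
      using h that zero \<open>a i = 0\<close> by (cases "k = i") auto
    ultimately have "?P I J a b h" using h by auto
    then show ?thesis by blast
  qed
  show ?case
  proof (cases "\<exists>i\<in>I. \<exists>j\<in>J. R i j")
    case False
    show ?thesis
    proof (cases "I = {}")
      case True
      then show ?thesis using b0 by (intro exI[of _ "\<lambda>_ _. 0"]) auto
    next
      case ne: False
      then obtain i where i: "i \<in> I" by blast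
      \<comment> \<open>With no admissible pair, Hall's condition for a singleton bounds its supply
        by an empty sum, so that supply is zero.\<close>
      have "{j\<in>J. R i j} = {}" using i False by auto
      then have "{j\<in>J. \<exists>k\<in>{i}. R k j} = {}" by auto
      moreover have "sum a {i} \<le> sum b {j\<in>J. \<exists>k\<in>{i}. R k j}" using i by (intro Hall) simp
      ultimately have "a i \<le> 0" by (simp only: sum.empty) simp
      then have "a i = 0" using a0[OF i] by simp
      then show ?thesis using drop_row[OF i _ a0 b0 Hall] by blast
    qed
  next
    case True
    then obtain i j where i: "i \<in> I" and j: "j \<in> J" and R: "R i j" by blast
    \<comment> \<open>Route as much as Hall's condition permits along the edge \<open>(i, j)\<close>: then the supply of \<open>i\<close> or
      the capacity of \<open>j\<close> is exhausted, or some \<open>S\<close> becomes tight and the problem splits at \<open>S\<close>.\<close>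
    define N where "N S = {j\<in>J. \<exists>i\<in>S. R i j}" for S
    \<comment> \<open>Lowering \<open>a i\<close> and \<open>b j\<close> by the same amount changes
      both sides of Hall's inequality equally if \<open>i \<in> S\<close>. Only sets that omit
      \<open>i\<close> but have \<open>j\<close> as a neighbour lose slack, so their slacks join
      \<open>a i\<close> and \<open>b j\<close> as upper bounds for \<epsilon>.\<close>
    define F where "F = {S. S \<subseteq> I - {i} \<and> j \<in> N S}"
    define E where "E = {a i, b j} \<union> (\<lambda>S. sum b (N S) - sum a S) ` F"
    define \<epsilon> where "\<epsilon> = Min E"
    define a' where "a' = a(i := a i - \<epsilon>)"
    define b' where "b' = b(j := b j - \<epsilon>)"
    have finN: "finite (N S)" and NJ: "N S \<subseteq> J" for S using fin by (auto simp: N_def)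
    have "F \<subseteq> Pow I" by (auto simp: F_def)
    then have finF: "finite F" using fin by (meson finite_Pow_iff finite_subset)
    then have finE: "finite E" and neE: "E \<noteq> {}" by (auto simp: E_def)
    have \<epsilon>E: "\<epsilon> \<in> E" unfolding \<epsilon>_def using finE neE by (rule Min_in)
    have \<epsilon>_le: "\<epsilon> \<le> e" if "e \<in> E" for e unfolding \<epsilon>_def using finE that by (rule Min_le)
    have \<epsilon>0: "\<epsilon> \<ge> 0"
    proof -
      have "0 \<le> sum b (N S) - sum a S" if "S \<in> F" for S
      proof -
        have "S \<subseteq> I" using that by (auto simp: F_def)
        from Hall[OF this] show ?thesis by (simp add: N_def)
      qed
      then show ?thesis using \<epsilon>E a0[OF i] b0[OF j] unfolding E_def by blast
    qed
    have a'0: "a' k \<ge> 0" if "k \<in> I" for k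
      using that a0 \<epsilon>_le[of "a i"] by (auto simp: a'_def E_def)
    have b'0: "b' k \<ge> 0" if "k \<in> J" for k
      using that b0 \<epsilon>_le[of "b j"] by (auto simp: b'_def E_def)
    have sum_a': "sum a' S = sum a S - (if i \<in> S then \<epsilon> else 0)" if "finite S" for S
    proof -
      have "sum a' S = (\<Sum>k\<in>S. a k - (if k = i then \<epsilon> else 0))"
        by (rule sum.cong) (auto simp: a'_def)
      then show ?thesis using that by (simp add: sum_subtractf)
    qed
    have sum_b': "sum b' S = sum b S - (if j \<in> S then \<epsilon> else 0)" if "finite S" for S
    proof -
      have "sum b' S = (\<Sum>k\<in>S. b k - (if k = j then \<epsilon> else 0))"
        by (rule sum.cong) (auto simp: b'_def)
      then show ?thesis using that by (simp add: sum_subtractf)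
    qed
    have Hall': "sum a' S \<le> sum b' (N S)" if S: "S \<subseteq> I" for S
    proof -
      have finS: "finite S" using S fin finite_subset by blast
      have le: "sum a S \<le> sum b (N S)" using Hall[OF S] by (simp add: N_def)
      show ?thesis
      proof (cases "i \<in> S")
        case True
        then have "j \<in> N S" using j R by (auto simp: N_def)
        then show ?thesis using le True by (simp add: sum_a' sum_b' finS finN)
      next
        case iS: False
        show ?thesis
        proof (cases "j \<in> N S")
          case True
          then have "\<epsilon> \<le> sum b (N S) - sum a S"
            using iS S by (intro \<epsilon>_le) (auto simp: E_def F_def)
          then show ?thesis using iS True by (simp add: sum_a' sum_b' finS finN)
        next
          case False
          then show ?thesis using le iS by (simp add: sum_a' sum_b' finS finN)
        qed
      qed
    qed
    have "\<exists>h. ?P I J a' b' h"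
    proof -
      consider "\<epsilon> = a i" | "\<epsilon> = b j" | S where "S \<in> F" "\<epsilon> = sum b (N S) - sum a S"
        using \<epsilon>E by (auto simp: E_def)
      then show ?thesis
      proof cases
        case 1
        then have "a' i = 0" by (simp add: a'_def)
        then show ?thesis using drop_row[OF i _ a'0 b'0] Hall' by (simp add: N_def)
      next
        case 2
        then have b'j: "b' j = 0" by (simp add: b'_def)
        have "\<exists>h. ?P I (J - {j}) a' b' h"
        proof (rule less.hyps)
          show "card I + card (J - {j}) < card I + card J"
            using card_Diff1_less[OF fin(2) j] by simp
          show "sum a' S \<le> sum b' {k \<in> J - {j}. \<exists>i\<in>S. R i k}" if "S \<subseteq> I" for S
          proof -
            have "sum b' {k \<in> J - {j}. \<exists>i\<in>S. R i k} = sum b' (N S)"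
              using b'j by (intro sum.mono_neutral_left finN) (auto simp: N_def)
            then show ?thesis using Hall'[OF that] by simp
          qed
        qed (use fin a'0 b'0 in auto)
        then obtain h where h: "?P I (J - {j}) a' b' h" by blast
        have zero: "h i j = 0" for i using h by blast
        have "(\<Sum>k\<in>J. h i k) = (\<Sum>k\<in>J - {j}. h i k)" for i
          using j fin zero by (simp add: sum.remove)
        moreover have "(\<Sum>i\<in>I. h i k) \<le> b' k" if "k \<in> J" for k
          using h that zero b'j by (cases "k = j") auto
        ultimately have "?P I J a' b' h" using h by auto
        then show ?thesis by blast
      next
        case 3
        \<comment> \<open>\<open>S\<close> omits \<open>i\<close>, and it is nonempty because
          \<open>j\<close> is one of its neighbours. Hence both \<open>S\<close> and
          \<open>I - S\<close> are proper subsets of \<open>I\<close>, and the induction hypothesis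
          applies to each.\<close>
        have SI: "S \<subseteq> I" and iS: "i \<notin> S" and jN: "j \<in> N S" using 3 by (auto simp: F_def)
        have finS: "finite S" using SI fin finite_subset by blast
        have S_ne: "S \<noteq> {}" using jN by (auto simp: N_def)
        have tight: "sum a' S = sum b' (N S)"
          using 3 iS jN by (simp add: sum_a' sum_b' finS finN)
        have "\<exists>h. ?P S (N S) a' b' h"
        proof (rule less.hyps)
          have "card S < card I" using SI iS i fin by (intro psubset_card_mono) auto
          moreover have "card (N S) \<le> card J" using NJ fin by (simp add: card_mono)
          ultimately show "card S + card (N S) < card I + card J" by simp
          show "sum a' T \<le> sum b' {j \<in> N S. \<exists>i\<in>T. R i j}" if "T \<subseteq> S" for T
          proof -
            have "{j \<in> N S. \<exists>i\<in>T. R i j} = N T" using that by (auto simp: N_def)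
            then show ?thesis using Hall'[of T] that SI by auto
          qed
        qed (use finS finN[of S] a'0 b'0 SI NJ[of S] in auto)
        then obtain h1 where h1: "?P S (N S) a' b' h1" by blast
        have "\<exists>h. ?P (I - S) (J - N S) a' b' h"
        proof (rule less.hyps)
          have "card (I - S) < card I" using SI S_ne fin by (intro psubset_card_mono) auto
          moreover have "card (J - N S) \<le> card J" using fin by (simp add: card_mono)
          ultimately show "card (I - S) + card (J - N S) < card I + card J" by simp
          show "sum a' T \<le> sum b' {j \<in> J - N S. \<exists>i\<in>T. R i j}" if T: "T \<subseteq> I - S" for T
          proof -
            have finT: "finite T" using T fin finite_subset by blast
            let ?M = "{j \<in> J - N S. \<exists>i\<in>T. R i j}"
            \<comment> \<open>Hall's condition passes to the complement of a tight set: apply it to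
              \<open>T \<union> S\<close> and cancel the equality for \<open>S\<close>.\<close>
            have "sum a' T + sum a' S = sum a' (T \<union> S)"
              using T finT finS by (subst sum.union_disjoint) auto
            also have "\<dots> \<le> sum b' (N (T \<union> S))" using T SI by (intro Hall') auto
            also have "N (T \<union> S) = ?M \<union> N S" by (auto simp: N_def)
            also have "sum b' \<dots> = sum b' ?M + sum b' (N S)"
              using fin finN by (intro sum.union_disjoint) auto
            finally show ?thesis using tight by simp
          qed
        qed (use fin a'0 b'0 in auto)
        then obtain h2 where h2: "?P (I - S) (J - N S) a' b' h2" by blast
        \<comment> \<open>The supports lie in the blocks \<open>S\<close>, \<open>N S\<close> and
          \<open>I - S\<close>, \<open>J - N S\<close>, so each row and each column receives a
          contribution from only one of the two solutions.\<close>
        define h where "h k l = h1 k l + h2 k l" for k l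
        have z1: "h1 k l = 0" if "k \<notin> S \<or> l \<notin> N S" for k l using h1 that by blast
        have z2: "h2 k l = 0" if "k \<in> S \<or> l \<in> N S \<or> k \<notin> I \<or> l \<notin> J" for k l using h2 that by blast
        have J_split: "J = N S \<union> (J - N S)" and I_split: "I = S \<union> (I - S)"
          using NJ SI by auto
        have row: "(\<Sum>l\<in>J. h k l) = (\<Sum>l\<in>N S. h1 k l) + (\<Sum>l\<in>J - N S. h2 k l)" for k
          unfolding h_def using fin finN z1 z2
          by (subst J_split, subst sum.union_disjoint) auto
        have col: "(\<Sum>k\<in>I. h k l) = (\<Sum>k\<in>S. h1 k l) + (\<Sum>k\<in>I - S. h2 k l)" for l
          unfolding h_def using fin finS z1 z2
          by (subst I_split, subst sum.union_disjoint) auto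
        have "(\<Sum>l\<in>J. h k l) = a' k" if "k \<in> I" for k
        proof (cases "k \<in> S")
          case True
          then have "sum (h1 k) (N S) = a' k" using h1 by blast
          then show ?thesis using True unfolding row by (simp add: z2)
        next
          case False
          then have "sum (h2 k) (J - N S) = a' k" using h2 that by blast
          then show ?thesis using False unfolding row by (simp add: z1)
        qed
        moreover have "(\<Sum>k\<in>I. h k l) \<le> b' l" if "l \<in> J" for l
        proof (cases "l \<in> N S")
          case True
          then have "(\<Sum>k\<in>S. h1 k l) \<le> b' l" using h1 by blast
          then show ?thesis using True unfolding col by (simp add: z2)
        next
          case False
          then have "(\<Sum>k\<in>I - S. h2 k l) \<le> b' l" using h2 that by blast
          then show ?thesis using False unfolding col by (simp add: z1)
        qed
        moreover have "h k l \<ge> 0" for k l using h1 h2 by (simp add: h_def)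
        moreover have "k \<in> I \<and> l \<in> J \<and> R k l" if "h k l \<noteq> 0" for k l
        proof -
          have "h1 k l \<noteq> 0 \<or> h2 k l \<noteq> 0" using that by (auto simp: h_def)
          then show ?thesis using h1 h2 SI NJ[of S] by blast
        qed
        ultimately have "?P I J a' b' h" by blast
        then show ?thesis by blast
      qed
    qed
    then obtain h where h: "?P I J a' b' h" by blast
    \<comment> \<open>Sending the amount \<epsilon> along the pair \<open>(i, j)\<close> makes up
      for what was taken from \<open>a i\<close> and \<open>b j\<close>.\<close>
    define h' where "h' k l = h k l + (if k = i then if l = j then \<epsilon> else 0 else 0)" for k l
    have "(\<Sum>l\<in>J. h' k l) = a k" if "k \<in> I" for k
    proof -
      have "(\<Sum>l\<in>J. h' k l) = (\<Sum>l\<in>J. h k l) + (if k = i then \<epsilon> else 0)"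
        using fin j by (simp add: h'_def sum.distrib)
      also have "\<dots> = a k" using h that by (simp add: a'_def)
      finally show ?thesis .
    qed
    moreover have "(\<Sum>k\<in>I. h' k l) \<le> b l" if "l \<in> J" for l
    proof -
      have "(\<Sum>k\<in>I. h' k l) = (\<Sum>k\<in>I. h k l) + (if l = j then \<epsilon> else 0)"
        using fin i by (simp add: h'_def sum.distrib)
      also have "(\<Sum>k\<in>I. h k l) \<le> b' l" using h that by blast
      also have "b' l + (if l = j then \<epsilon> else 0) = b l" by (simp add: b'_def)
      finally show ?thesis by simp
    qed
    moreover have "h' k l \<ge> 0" for k l using h \<epsilon>0 by (simp add: h'_def)
    moreover have "k \<in> I \<and> l \<in> J \<and> R k l" if "h' k l \<noteq> 0" for k l
    proof (cases "k = i \<and> l = j")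
      case False
      then have "h k l \<noteq> 0" using that by (auto simp: h'_def split: if_splits)
      then show ?thesis using h by blast
    qed (use i j R in simp)
    ultimately have "?P I J a b h'" by blast
    then show ?thesis by blast
  qed
qed

section \<open>From vertex expansion to a lower bound for the Dirichlet form\<close>

text \<open>By convexity the extremal configuration for \<open>c \<le> 1\<close> has entries
  \<open>1\<close>, \<open>c\<close> and zeros. Bounding squares by the maximum times the sum
  settles \<open>c \<ge> 1\<close> and the case of all entries at most \<open>c\<close>. Otherwise
  all entries but a largest one are merged into their sum, which does not decrease the sum of
  squares.\<close>

lemma sum_squares_le_of_sum_eq_one_plus:
  fixes a :: "'a \<Rightarrow> real"
  assumes fin: "finite J" and a: "\<And>j. j \<in> J \<Longrightarrow> 0 \<le> a j" "\<And>j. j \<in> J \<Longrightarrow> a j \<le> 1"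
    and sum: "(\<Sum>j\<in>J. a j) = 1 + c" and "c \<ge> 0"
  shows "(\<Sum>j\<in>J. (a j)\<^sup>2) \<le> 1 + c\<^sup>2"
proof -
  have sq_le: "(\<Sum>j\<in>K. (a j)\<^sup>2) \<le> m * (\<Sum>j\<in>K. a j)"
    if "K \<subseteq> J" "\<And>j. j \<in> K \<Longrightarrow> a j \<le> m" for K m
    unfolding sum_distrib_left power2_eq_square
    using that a by (intro sum_mono mult_right_mono) auto
  show ?thesis
  proof (cases "c \<ge> 1")
    case True
    then have "c \<le> c\<^sup>2" by (simp add: power2_eq_square)
    then show ?thesis using sq_le[of J 1] a sum by simp
  next
    case False
    have "J \<noteq> {}" using sum \<open>c \<ge> 0\<close> by auto
    then have "Max (a ` J) \<in> a ` J" using fin by simp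
    then obtain k where k: "k \<in> J" "a k = Max (a ` J)" by auto
    have max: "a j \<le> a k" if "j \<in> J" for j using that fin k by simp
    show ?thesis
    proof (cases "a k \<le> c")
      case True
      have "(\<Sum>j\<in>J. (a j)\<^sup>2) \<le> c * (1 + c)"
        using sq_le[of J c] max True sum by fastforce
      also have "\<dots> \<le> 1 + c\<^sup>2" using False by (simp add: power2_eq_square algebra_simps)
      finally show ?thesis .
    next
      case ak: False
      define r where "r = (\<Sum>j\<in>J - {k}. a j)"
      have r: "a k + r = 1 + c" using sum fin k by (simp add: r_def sum.remove)
      have "a j \<le> r" if "j \<in> J - {k}" for j
        unfolding r_def using that fin a by (intro member_le_sum) auto
      then have "(\<Sum>j\<in>J - {k}. (a j)\<^sup>2) \<le> r * r"
        using sq_le[of "J - {k}" r] by (simp add: r_def)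
      then have "(\<Sum>j\<in>J. (a j)\<^sup>2) \<le> (a k)\<^sup>2 + r * r"
        using fin k by (simp add: sum.remove)
      also have "\<dots> \<le> 1 + c\<^sup>2"
      proof -
        \<comment> \<open>The pairs \<open>a k\<close>, \<open>r\<close> and \<open>1\<close>,
          \<open>c\<close> have the same sum, and twice this product is exactly the difference of
          their sums of squares.\<close>
        have "0 \<le> (1 - a k) * (a k - c)" using ak a(2)[OF k(1)] by simp
        moreover have r: "r = 1 + c - a k" using r by simp
        ultimately show ?thesis unfolding r by (simp add: power2_eq_square algebra_simps)
      qed
      finally show ?thesis .
    qed
  qed
qed

text \<open>The double sum visits each edge in both directions, which is why the constant is twice
  that of the Laplacian bound. \<open>W\<close> stands for the complement of the set where the
  vector is forced to vanish.\<close>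

lemma Dirichlet_form_ge_of_vertex_expansion:
  fixes y :: "'a \<Rightarrow> real"
  assumes fin: "finite V" and sym: "\<And>i j. E i j \<Longrightarrow> E j i" and "W \<subseteq> V" and "c \<ge> 0"
    and expand: "\<And>S. S \<subseteq> W \<Longrightarrow> c * real (card S) \<le> real (card ({v\<in>V. \<exists>w\<in>S. E v w} - S))"
    and yW: "\<And>i. i \<in> V - W \<Longrightarrow> y i = 0"
  shows "c\<^sup>2 / (2 + c\<^sup>2) * (\<Sum>i\<in>V. (y i)\<^sup>2)
           \<le> (\<Sum>i\<in>V. \<Sum>j\<in>V. if E i j then (y i - y j)\<^sup>2 else 0)"
proof -
  define Y where "Y = (\<Sum>i\<in>V. (y i)\<^sup>2)"
  define D where "D = (\<Sum>i\<in>V. \<Sum>j\<in>V. if E i j then (y i - y j)\<^sup>2 else 0)"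
  have finW: "finite W" using fin \<open>W \<subseteq> V\<close> finite_subset by blast
  have "\<exists>h. (\<forall>i j. h i j \<ge> 0) \<and> (\<forall>i j. h i j \<noteq> 0 \<longrightarrow> i \<in> W \<and> j \<in> V \<and> (i = j \<or> E i j)) \<and>
           (\<forall>i\<in>W. (\<Sum>j\<in>V. h i j) = 1 + c) \<and> (\<forall>j\<in>V. (\<Sum>i\<in>W. h i j) \<le> 1)"
  proof (rule fractional_Hall)
    show "(\<Sum>i\<in>S. 1 + c) \<le> (\<Sum>j\<in>{j\<in>V. \<exists>i\<in>S. i = j \<or> E i j}. 1)" if S: "S \<subseteq> W" for S
    proof -
      let ?N = "{v\<in>V. \<exists>w\<in>S. E v w}"
      have finS: "finite S" using S finW finite_subset by blast
      have "{j\<in>V. \<exists>i\<in>S. i = j \<or> E i j} = S \<union> (?N - S)"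
        using S \<open>W \<subseteq> V\<close> sym by blast
      then have "card {j\<in>V. \<exists>i\<in>S. i = j \<or> E i j} = card S + card (?N - S)"
        using fin finS by (simp only:) (rule card_Un_disjoint, auto)
      then show ?thesis using expand[OF S] by (simp add: algebra_simps)
    qed
  qed (use fin finW \<open>c \<ge> 0\<close> in auto)
  then obtain h where h0: "\<And>i j. h i j \<ge> 0"
    and supp: "\<And>i j. h i j \<noteq> 0 \<Longrightarrow> i \<in> W \<and> j \<in> V \<and> (i = j \<or> E i j)"
    and row: "\<And>i. i \<in> W \<Longrightarrow> (\<Sum>j\<in>V. h i j) = 1 + c"
    and colW: "\<And>j. j \<in> V \<Longrightarrow> (\<Sum>i\<in>W. h i j) \<le> 1"
    by metis
  have col: "(\<Sum>i\<in>V. h i j) \<le> 1" if "j \<in> V" for j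
  proof -
    have "(\<Sum>i\<in>V. h i j) = (\<Sum>i\<in>W. h i j)"
      using fin \<open>W \<subseteq> V\<close> supp by (intro sum.mono_neutral_right) auto
    then show ?thesis using colW[OF that] by simp
  qed
  have h1: "h i j \<le> 1" if "i \<in> V" "j \<in> V" for i j
    using member_le_sum[of i V "\<lambda>i. h i j"] that fin h0 col[of j] by fastforce
  \<comment> \<open>Antisymmetrising cancels the diagonal of \<open>h\<close>, the part of its
    supply that a vertex keeps, so \<open>g\<close> lives on edges only.\<close>
  define g where "g i j = h i j - h j i" for i j
  have g_supp: "g i j = 0" if "\<not> E i j" for i j
    using supp[of i j] supp[of j i] that sym[of j i] by (cases "i = j"; cases "h i j = 0"; cases "h j i = 0") (auto simp: g_def)
  have g_sq: "(\<Sum>j\<in>V. (g i j)\<^sup>2) \<le> 2 + c\<^sup>2" if "i \<in> V" for i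
  proof -
    \<comment> \<open>The cross term \<open>- 2 * h i j * h j i\<close> is nonpositive and is
      dropped. The row then contributes at most \<open>1 + c\<^sup>2\<close>, and the column at most
      \<open>1\<close>, since its entries lie between 0 and 1 and squaring does not increase
      them.\<close>
    have "(\<Sum>j\<in>V. (g i j)\<^sup>2) \<le> (\<Sum>j\<in>V. (h i j)\<^sup>2 + (h j i)\<^sup>2)"
      using h0 by (intro sum_mono) (simp add: g_def power2_diff)
    also have "\<dots> = (\<Sum>j\<in>V. (h i j)\<^sup>2) + (\<Sum>j\<in>V. (h j i)\<^sup>2)" by (rule sum.distrib)
    also have "(\<Sum>j\<in>V. (h i j)\<^sup>2) \<le> 1 + c\<^sup>2"
    proof (cases "i \<in> W")
      case True
      then show ?thesis
        using fin h0 h1 that row \<open>c \<ge> 0\<close>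
        by (intro sum_squares_le_of_sum_eq_one_plus) auto
    next
      case False
      then have "h i j = 0" for j using supp by blast
      then show ?thesis by simp
    qed
    also have "(\<Sum>j\<in>V. (h j i)\<^sup>2) \<le> (\<Sum>j\<in>V. h j i)"
      using h0 h1 that by (intro sum_mono) (simp add: power2_eq_square mult_left_le)
    also have "\<dots> \<le> 1" using col[OF that] .
    finally show ?thesis by simp
  qed
  have flow: "2 * c * Y \<le> (\<Sum>i\<in>V. \<Sum>j\<in>V. g i j * ((y i)\<^sup>2 - (y j)\<^sup>2))"
  proof -
    have "c * Y \<le> (\<Sum>i\<in>V. (y i)\<^sup>2 * (\<Sum>j\<in>V. g i j))"
      unfolding Y_def sum_distrib_left
    proof (rule sum_mono)
      fix i assume "i \<in> V"
      show "c * (y i)\<^sup>2 \<le> (\<Sum>j\<in>V. (y i)\<^sup>2 * g i j)"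
      proof (cases "i \<in> W")
        case True
        have "c \<le> (\<Sum>j\<in>V. g i j)"
          using row[OF True] col[OF \<open>i \<in> V\<close>] by (simp add: g_def sum_subtractf)
        then show ?thesis
          unfolding sum_distrib_left[symmetric] mult.commute[of c "(y i)\<^sup>2"]
          by (intro mult_left_mono) auto
      next
        case False
        \<comment> \<open>Outside \<open>W\<close> rows of \<open>h\<close> vanish and the net
          outflow may be negative, but there the weight \<open>(y i)\<^sup>2\<close> is
          zero.\<close>
        then show ?thesis using yW \<open>i \<in> V\<close> by simp
      qed
    qed
    moreover have "(\<Sum>i\<in>V. \<Sum>j\<in>V. g i j * ((y i)\<^sup>2 - (y j)\<^sup>2))
        = 2 * (\<Sum>i\<in>V. (y i)\<^sup>2 * (\<Sum>j\<in>V. g i j))"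
    proof -
      \<comment> \<open>By antisymmetry of \<open>g\<close>, the terms with \<open>y j\<close>
        repeat those with \<open>y i\<close> up to sign; subtracting them produces the factor
        2.\<close>
      have "(\<Sum>i\<in>V. \<Sum>j\<in>V. g i j * (y j)\<^sup>2) = (\<Sum>j\<in>V. \<Sum>i\<in>V. - (g j i * (y j)\<^sup>2))"
        by (subst sum.swap) (simp add: g_def algebra_simps)
      then show ?thesis
        by (simp add: right_diff_distrib sum_subtractf sum_negf sum_distrib_left
            mult.commute[of "g _ _"])
    qed
    ultimately show ?thesis by simp
  qed
  have energy: "(\<Sum>i\<in>V. \<Sum>j\<in>V. (g i j)\<^sup>2 * (y i + y j)\<^sup>2) \<le> 4 * (2 + c\<^sup>2) * Y"
  proof -
    have sq: "(y i + y j)\<^sup>2 \<le> 2 * (y i)\<^sup>2 + 2 * (y j)\<^sup>2" for i j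
      using zero_le_power2[of "y i - y j"] by (simp add: power2_sum power2_diff)
    have "(\<Sum>i\<in>V. \<Sum>j\<in>V. (g i j)\<^sup>2 * (y i + y j)\<^sup>2)
        \<le> (\<Sum>i\<in>V. \<Sum>j\<in>V. (g i j)\<^sup>2 * (2 * (y i)\<^sup>2 + 2 * (y j)\<^sup>2))"
      using sq by (intro sum_mono mult_left_mono) auto
    also have "\<dots> = (\<Sum>i\<in>V. \<Sum>j\<in>V. 2 * (y i)\<^sup>2 * (g i j)\<^sup>2)
        + (\<Sum>i\<in>V. \<Sum>j\<in>V. 2 * (y j)\<^sup>2 * (g i j)\<^sup>2)"
      by (simp add: algebra_simps sum.distrib)
    \<comment> \<open>The square of \<open>g\<close> is symmetric, so both halves agree and together
      give the factor 4.\<close>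
    also have "(\<Sum>i\<in>V. \<Sum>j\<in>V. 2 * (y j)\<^sup>2 * (g i j)\<^sup>2)
        = (\<Sum>i\<in>V. \<Sum>j\<in>V. 2 * (y i)\<^sup>2 * (g i j)\<^sup>2)"
      by (subst sum.swap) (simp add: g_def power2_commute)
    finally have "(\<Sum>i\<in>V. \<Sum>j\<in>V. (g i j)\<^sup>2 * (y i + y j)\<^sup>2)
        \<le> (\<Sum>i\<in>V. 4 * (y i)\<^sup>2 * (\<Sum>j\<in>V. (g i j)\<^sup>2))"
      by (simp add: sum_distrib_left mult.assoc flip: sum.distrib)
    also have "\<dots> \<le> (\<Sum>i\<in>V. 4 * (y i)\<^sup>2 * (2 + c\<^sup>2))"
      using g_sq by (intro sum_mono mult_left_mono) auto
    also have "\<dots> = 4 * (2 + c\<^sup>2) * Y"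
      unfolding Y_def sum_distrib_left by (intro sum.cong) (simp_all add: algebra_simps)
    finally show ?thesis .
  qed
  \<comment> \<open>The Cauchy-Schwarz inequality in the form \<open>2 t u v \<le> t\<^sup>2 u\<^sup>2 + v\<^sup>2\<close>; this \<open>t\<close> is optimal.\<close>
  define t where "t = c / (2 * (2 + c\<^sup>2))"
  have pos: "2 + c\<^sup>2 > 0" by (smt (verit) zero_le_power2)
  have "t \<ge> 0" using \<open>c \<ge> 0\<close> pos by (simp add: t_def)
  have "2 * t * (\<Sum>i\<in>V. \<Sum>j\<in>V. g i j * ((y i)\<^sup>2 - (y j)\<^sup>2))
      \<le> t\<^sup>2 * (\<Sum>i\<in>V. \<Sum>j\<in>V. (g i j)\<^sup>2 * (y i + y j)\<^sup>2) + D"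
    unfolding D_def sum_distrib_left sum.distrib[symmetric]
  proof (intro sum_mono)
    fix i j
    show "2 * t * (g i j * ((y i)\<^sup>2 - (y j)\<^sup>2))
        \<le> t\<^sup>2 * ((g i j)\<^sup>2 * (y i + y j)\<^sup>2) + (if E i j then (y i - y j)\<^sup>2 else 0)"
    proof (cases "E i j")
      case True
      have "0 \<le> (t * g i j * (y i + y j) - (y i - y j))\<^sup>2" by simp
      also have "\<dots> = t\<^sup>2 * ((g i j)\<^sup>2 * (y i + y j)\<^sup>2) + (y i - y j)\<^sup>2
          - 2 * t * (g i j * ((y i)\<^sup>2 - (y j)\<^sup>2))"
        by (simp add: power2_eq_square algebra_simps)
      finally show ?thesis using True by simp
    qed (simp add: g_supp)
  qed
  moreover have "2 * t * (2 * c * Y) \<le> 2 * t * (\<Sum>i\<in>V. \<Sum>j\<in>V. g i j * ((y i)\<^sup>2 - (y j)\<^sup>2))"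
    using flow \<open>t \<ge> 0\<close> by (intro mult_left_mono) auto
  moreover have "t\<^sup>2 * (\<Sum>i\<in>V. \<Sum>j\<in>V. (g i j)\<^sup>2 * (y i + y j)\<^sup>2) \<le> t\<^sup>2 * (4 * (2 + c\<^sup>2) * Y)"
    using energy by (intro mult_left_mono) auto
  ultimately have "2 * t * (2 * c * Y) - t\<^sup>2 * (4 * (2 + c\<^sup>2) * Y) \<le> D" by linarith
  moreover have "2 * t * (2 * c * Y) - t\<^sup>2 * (4 * (2 + c\<^sup>2) * Y) = c\<^sup>2 / (2 + c\<^sup>2) * Y"
  proof -
    \<comment> \<open>For this \<open>t\<close> the quadratic term equals
      \<open>2 * t * c * Y\<close>, half of the linear term, so the difference is again
      \<open>2 * t * c * Y\<close>.\<close>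
    have c: "c = 2 * (2 + c\<^sup>2) * t" using pos by (simp add: t_def)
    have "c\<^sup>2 / q = 2 * (c / (2 * q)) * c" for q by (simp add: power2_eq_square)
    then have "c\<^sup>2 / (2 + c\<^sup>2) = 2 * t * c" unfolding t_def .
    moreover have "t\<^sup>2 * (4 * (2 + c\<^sup>2) * Y) = 2 * t * (2 * (2 + c\<^sup>2) * t) * Y"
      by (simp add: power2_eq_square)
    then have "t\<^sup>2 * (4 * (2 + c\<^sup>2) * Y) = 2 * t * c * Y" using c by simp
    ultimately show ?thesis by (simp only:)
  qed
  ultimately show ?thesis by (simp add: D_def Y_def)
qed

section \<open>The quadratic form of the Laplace matrix\<close>

text \<open>Degrees count arcs; without parallel arcs \<open>head G\<close> maps the arcs leaving
  \<open>v\<close> bijectively onto its out-neighbours.\<close>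

lemma (in nomulti_digraph) out_degree_eq_card_out_neighbours:
  "out_degree G v = card {w. v \<rightarrow>\<^bsub>G\<^esub> w}"
proof -
  have "head G ` out_arcs G v = {w. v \<rightarrow>\<^bsub>G\<^esub> w}"
    by (force simp: out_arcs_def arcs_ends_def arc_to_ends_def)
  moreover have "inj_on (head G) (out_arcs G v)"
    using no_multi_arcs by (auto simp: inj_on_def out_arcs_def arc_to_ends_def)
  ultimately show ?thesis unfolding out_degree_def by (metis card_image)
qed

lemma laplace_quadratic_form:
  fixes G :: "(nat, 'b) pre_digraph" and x :: "real vec"
  assumes "graph G" and V: "verts G = {0..<n}" and x: "x \<in> carrier_vec n"
  shows "x \<bullet> (laplace_mat n G *\<^sub>v x)
    = (\<Sum>i<n. \<Sum>j<n. if i \<rightarrow>\<^bsub>G\<^esub> j then (x $ i - x $ j)\<^sup>2 else 0) / 2"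
proof -
  interpret graph G by fact
  let ?A = "\<lambda>i j. if i \<rightarrow>\<^bsub>G\<^esub> j then 1 else 0 :: real"
  have sym: "?A i j = ?A j i" for i j 
    using arcs_ends_symmetric[OF sym_arcs] by auto
  have deg: "real (out_degree G i) = (\<Sum>j<n. ?A i j)" for i
  proof -
    have "{w. i \<rightarrow>\<^bsub>G\<^esub> w} = {j\<in>{..<n}. i \<rightarrow>\<^bsub>G\<^esub> j}"
      using adj_in_verts V by auto
    then show ?thesis by (simp add: out_degree_eq_card_out_neighbours flip: sum.inter_filter)
  qed
  have "x \<bullet> (laplace_mat n G *\<^sub>v x)
      = (\<Sum>i<n. x $ i * (\<Sum>j<n. ((if i = j then real (out_degree G i) else 0) - ?A i j) * x $ j))"
    using x by (auto simp: laplace_mat_def adjacency_mat_def mat_diag_def scalar_prod_def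
        lessThan_atLeast0 intro!: sum.cong)
  also have "\<dots> = (\<Sum>i<n. real (out_degree G i) * (x $ i)\<^sup>2 - (\<Sum>j<n. ?A i j * (x $ i * x $ j)))"
  proof (rule sum.cong[OF refl])
    fix i assume i: "i \<in> {..<n}"
    have "(\<Sum>j<n. ((if i = j then real (out_degree G i) else 0) - ?A i j) * x $ j)
      = (\<Sum>j<n. (if i = j then real (out_degree G i) * x $ j else 0) - ?A i j * x $ j)"
      by (intro sum.cong) (auto simp: algebra_simps)
    also have "\<dots> = real (out_degree G i) * x $ i - (\<Sum>j<n. ?A i j * x $ j)"
      using i by (simp only: sum_subtractf sum.delta' finite_lessThan if_True)
    finally show "x $ i * (\<Sum>j<n. ((if i = j then real (out_degree G i) else 0) - ?A i j) * x $ j)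
      = real (out_degree G i) * (x $ i)\<^sup>2 - (\<Sum>j<n. ?A i j * (x $ i * x $ j))"
      by (simp only: right_diff_distrib sum_distrib_left power2_eq_square mult.assoc
          mult.left_commute mult.commute)
  qed
  also have "\<dots> = (\<Sum>i<n. \<Sum>j<n. ?A i j * (x $ i)\<^sup>2) - (\<Sum>i<n. \<Sum>j<n. ?A i j * (x $ i * x $ j))"
    by (simp only: sum_subtractf deg sum_distrib_right)
  also have "\<dots> = (\<Sum>i<n. \<Sum>j<n. ?A i j * (x $ i - x $ j)\<^sup>2) / 2"
  proof -
    \<comment> \<open>Symmetry of adjacency makes the degree term equal to half the sum of its
      \<open>x $ i\<close> and \<open>x $ j\<close> versions, which completes the square.\<close>
    have swap: "(\<Sum>i<n. \<Sum>j<n. ?A i j * (x $ j)\<^sup>2) = (\<Sum>i<n. \<Sum>j<n. ?A i j * (x $ i)\<^sup>2)"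
      by (subst sum.swap) (simp only: sym)
    have "?A i j * (x $ i - x $ j)\<^sup>2
        = ?A i j * (x $ i)\<^sup>2 + ?A i j * (x $ j)\<^sup>2 - 2 * (?A i j * (x $ i * x $ j))" for i j
      by (simp add: power2_diff)
    then show ?thesis
      by (simp only: sum_subtractf sum.distrib swap flip: sum_distrib_left) simp
  qed
  also have "(\<Sum>i<n. \<Sum>j<n. ?A i j * (x $ i - x $ j)\<^sup>2)
      = (\<Sum>i<n. \<Sum>j<n. if i \<rightarrow>\<^bsub>G\<^esub> j then (x $ i - x $ j)\<^sup>2 else 0)"
    by (intro sum.cong) auto
  finally show ?thesis .
qed

theorem theorem5:
  fixes G :: "(nat, 'b) pre_digraph" and n :: nat and U :: "nat set"
    and c :: real and x :: "real vec"
  assumes "graph G" and "verts G = {0..<n}"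
    and "U \<subseteq> verts G"
    and "c \<ge> 0"
    and "\<And>W. W \<subseteq> verts G - U \<Longrightarrow>
           real (card (neighborhood G W - W)) \<ge> c * real (card W)"
    and "x \<in> carrier_vec n"
    and "\<And>j. j \<in> U \<Longrightarrow> x $ j = 0"
  shows "x \<bullet> (laplace_mat n G *\<^sub>v x) \<ge> c\<^sup>2 / (4 + 2 * c\<^sup>2) * (\<Sum>i\<in>verts G. (x $ i)\<^sup>2)"
proof -
  interpret graph G by fact
  have V: "verts G = {..<n}" using assms(2) by (simp add: lessThan_atLeast0)
  have "c\<^sup>2 / (2 + c\<^sup>2) * (\<Sum>i\<in>verts G. (x $ i)\<^sup>2)
      \<le> (\<Sum>i\<in>verts G. \<Sum>j\<in>verts G. if i \<rightarrow>\<^bsub>G\<^esub> j then (x $ i - x $ j)\<^sup>2 else 0)"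
  proof (rule Dirichlet_form_ge_of_vertex_expansion[where W = "verts G - U"])
    show "c * real (card S) \<le> real (card ({v \<in> verts G. \<exists>w\<in>S. v \<rightarrow>\<^bsub>G\<^esub> w} - S))"
      if "S \<subseteq> verts G - U" for S
      using assms(5)[OF that] by (simp add: neighborhood_def)
    show "j \<rightarrow>\<^bsub>G\<^esub> i" if "i \<rightarrow>\<^bsub>G\<^esub> j" for i j
      using that by (rule arcs_ends_symmetric[OF sym_arcs])
  qed (use assms(4,7) in auto)
  also have "\<dots> = 2 * (x \<bullet> (laplace_mat n G *\<^sub>v x))"
    by (simp add: laplace_quadratic_form[OF assms(1,2,6)] V)
  finally have le: "c\<^sup>2 / (2 + c\<^sup>2) * (\<Sum>i\<in>verts G. (x $ i)\<^sup>2)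
      \<le> 2 * (x \<bullet> (laplace_mat n G *\<^sub>v x))" .
  \<comment> \<open>Halving undoes the double count of edges and turns the denominator
    \<open>2 + c\<^sup>2\<close> into \<open>4 + 2 * c\<^sup>2\<close>.\<close>
  have "c\<^sup>2 / (4 + 2 * c\<^sup>2) * s = c\<^sup>2 / (2 + c\<^sup>2) * s / 2" for s
    by (simp add: algebra_simps)
  then show ?thesis using divide_right_mono[OF le, of 2] by (simp only:) simp
qed

end
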